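(* Let $K$ be an infinite field. For any linear subspace $\mathcal{X}$ of the space $\operatorname{Mat}_{p,q}(K)$ of $p\times q$ matrices over $K$, we have $\operatorname{ncrk}(\mathcal{X}) < 2\operatorname{rk}(\mathcal{X})$.
   Context: For a linear subspace $\mathcal{X}\subseteq \operatorname{Mat}_{p,q}(K)$, $\operatorname{rk}(\mathcal{X})$ denotes the maximal rank among the members of $\mathcal{X}$. For $d\ge 1$, the tensor blow-up is $\mathcal{X}^{\{d\}}=\mathcal{X}\otimes \operatorname{Mat}_{d,d}(K)=\{\sum_i X_i\otimes T_i \mid X_i\in\mathcal{X},\ T_i\in\operatorname{Mat}_{d,d}(K)\}$, viewed (via the Kronecker product) as a linear subspace of $\operatorname{Mat}_{pd,qd}(K)$. The non-commutative rank is $\operatorname{ncrk}(\mathcal{X})=\max_{d\ge 1}\frac{\operatorname{rk}(\mathcal{X}^{\{d\}})}{d}=\lim_{d\to\infty}\frac{\operatorname{rk}(\mathcal{X}^{\{d\}})}{d}$ (both the maximum and the limit exist and they are equal).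
   Formalization: The linear subspace is assumed to be nonzero, since for the zero subspace both ncrk and rk are 0 and the strict inequality would read 0 < 0. *)

theory Defs
  imports Complex_Main "Jordan_Normal_Form.DL_Rank"
begin

definition kronecker_prod :: "'a::semiring_0 mat \<Rightarrow> 'a mat \<Rightarrow> 'a mat" where
  "kronecker_prod A B = mat (dim_row A * dim_row B) (dim_col A * dim_col B)
     (\<lambda>(i, j). A $$ (i div dim_row B, j div dim_col B) * B $$ (i mod dim_row B, j mod dim_col B))"

text \<open>\<open>vec_space.rank p A\<close> is the (column) rank of a matrix \<open>A\<close> with \<open>p\<close> rows. The set of ranks
  is finite, since ranks are bounded by the number of columns (lemma \<open>finite_ranks\<close>).\<close>

definition max_rank :: "nat \<Rightarrow> 'a::field mat set \<Rightarrow> nat" where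
  "max_rank p \<X> = Max (vec_space.rank p ` \<X>)"

definition blow_up :: "nat \<Rightarrow> nat \<Rightarrow> nat \<Rightarrow> 'a::field mat set \<Rightarrow> 'a mat set" where
  "blow_up p q d \<X> =
     {finsum (module_mat TYPE('a) (p * d) (q * d)) (\<lambda>i. kronecker_prod (Y i) (T i)) {..<n}
      | (n::nat) Y T. Y \<in> {..<n} \<rightarrow> \<X> \<and> T \<in> {..<n} \<rightarrow> carrier_mat d d}"

text \<open>The quotients are bounded (lemma \<open>bdd_above_ncrk\<close>) and their supremum is attained by a theorem
  in the literature, which makes it the maximum. Taking the supremum keeps the definition independent
  of that theorem.\<close>

definition ncrk :: "nat \<Rightarrow> nat \<Rightarrow> 'a::field mat set \<Rightarrow> real" where
  "ncrk p q \<X> = (SUP d\<in>{1..}. real (max_rank (p * d) (blow_up p q d \<X>)) / real d)"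

lemma finite_ranks:
  fixes \<X> :: "'a::field mat set"
  assumes "\<X> \<subseteq> carrier_mat p q"
  shows "finite (vec_space.rank p ` \<X>)"
proof (rule finite_subset)
  show "vec_space.rank p ` \<X> \<subseteq> {..q}"
    using assms vec_space.rank_le_nc by blast
qed simp

lemma blow_up_carrier:
  fixes \<X> :: "'a::field mat set"
  assumes "\<X> \<subseteq> carrier_mat p q"
  shows "blow_up p q d \<X> \<subseteq> carrier_mat (p * d) (q * d)"
proof
  fix A assume "A \<in> blow_up p q d \<X>"
  then obtain n :: nat and Y T
    where A: "A = finsum (module_mat TYPE('a) (p * d) (q * d)) (\<lambda>i. kronecker_prod (Y i) (T i)) {..<n}"
      and Y: "Y \<in> {..<n} \<rightarrow> \<X>" and T: "T \<in> {..<n} \<rightarrow> carrier_mat d d"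
    unfolding blow_up_def by blast
  interpret abelian_group "module_mat TYPE('a) (p * d) (q * d)"
    by (rule abelian_group_mat)
  have "(\<lambda>i. kronecker_prod (Y i) (T i)) \<in> {..<n} \<rightarrow> carrier_mat (p * d) (q * d)"
  proof
    fix i assume "i \<in> {..<n}"
    then have "Y i \<in> carrier_mat p q" "T i \<in> carrier_mat d d" using Y T assms by auto
    then show "kronecker_prod (Y i) (T i) \<in> carrier_mat (p * d) (q * d)"
      by (auto simp: kronecker_prod_def)
  qed
  then show "A \<in> carrier_mat (p * d) (q * d)"
    using finsum_closed[of "\<lambda>i. kronecker_prod (Y i) (T i)" "{..<n}"] A
    by (simp add: module_mat_simps)
qed

lemma zero_in_blow_up: "0\<^sub>m (p * d) (q * d) \<in> blow_up p q d (\<X> :: 'a::field mat set)"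
proof -
  interpret abelian_group "module_mat TYPE('a) (p * d) (q * d)"
    by (rule abelian_group_mat)
  show ?thesis unfolding blow_up_def
    by (intro CollectI exI[of _ "0::nat"]) (auto simp: module_mat_simps)
qed

lemma bdd_above_ncrk:
  fixes \<X> :: "'a::field mat set"
  assumes "\<X> \<subseteq> carrier_mat p q"
  shows "bdd_above ((\<lambda>d. real (max_rank (p * d) (blow_up p q d \<X>)) / real d) ` {1..})"
proof (intro bdd_aboveI2)
  fix d :: nat assume d: "d \<in> {1..}"
  have "blow_up p q d \<X> \<noteq> {}"
    using zero_in_blow_up[of p d q \<X>] by force
  then have "max_rank (p * d) (blow_up p q d \<X>) \<in> vec_space.rank (p * d) ` blow_up p q d \<X>"
    unfolding max_rank_def
    using Max_in[OF finite_ranks[OF blow_up_carrier[OF assms]]] by simp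
  then obtain A where A: "A \<in> blow_up p q d \<X>"
    and rank_A: "max_rank (p * d) (blow_up p q d \<X>) = vec_space.rank (p * d) A"
    by (rule imageE)
  have "A \<in> carrier_mat (p * d) (q * d)"
    using A blow_up_carrier[OF assms] by (rule rev_subsetD)
  then have "max_rank (p * d) (blow_up p q d \<X>) \<le> q * d"
    unfolding rank_A by (rule vec_space.rank_le_nc)
  then have "real (max_rank (p * d) (blow_up p q d \<X>)) \<le> real q * real d"
    by (metis of_nat_le_iff of_nat_mult)
  then show "real (max_rank (p * d) (blow_up p q d \<X>)) / real d \<le> real q"
    using d by (simp add: divide_le_eq)
qed

end

theory Submission
  imports Defs
begin

text \<open>The bound proved is \<open>ncrk \<X> \<le> 2 r - 1\<close> where \<open>r\<close> is the maximal rank in \<open>\<X>\<close>. As it is uniform in \<open>d\<close>,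
the strict inequality survives the supremum over all blow-ups.

Choose \<open>A\<close> in \<open>\<X>\<close> of rank \<open>r\<close> and coordinates in which \<open>A\<close> is an identity block of size \<open>r\<close> bordered by
zeros. For any \<open>B\<close> in \<open>\<X>\<close>, the matrices \<open>A + x B\<close> have rank at most \<open>r\<close> for all scalars \<open>x\<close>. Because the
field is infinite, this is a polynomial identity in \<open>x\<close>, and its lowest coefficients say
\<open>B22 = 0\<close> and \<open>B21 B12 = 0\<close> for the blocks of \<open>B\<close> (\<open>maximal_rank_pencil\<close>). The second equation gives
\<open>rank B21 + rank B12 \<le> r\<close>. A generic \<open>B\<close> attains the maximal rank in both corners simultaneously, so the
space of all blocks \<open>B21\<close> or the space of all blocks \<open>B12\<close> has maximal rank at most \<open>s = r div 2\<close>
(\<open>complementary_ranks_of_space\<close>).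

Suppose it is the space of the \<open>B21\<close>. A member of the blow-up of \<open>\<X>\<close> has \<open>r d\<close> upper rows and, since
\<open>B22 = 0\<close>, a lower part that comes from the blow-up of the space of the \<open>B21\<close>. By induction on the
maximal rank, its rank is at most \<open>r d + (2 s - 1) d \<le> (2 r - 1) d\<close> if \<open>s > 0\<close>, and at most \<open>r d\<close> if
\<open>s = 0\<close> (\<open>rank_blow_up_le\<close>). The other case is symmetric.

No coordinates are chosen below. A pair \<open>S, T\<close> with \<open>S A T = 1\<close> and \<open>A T S A = A\<close> takes their place;
the projections \<open>L = 1 - A T S\<close> and \<open>R = 1 - T S A\<close> select the lower rows and the right columns, so that
\<open>L B\<close> and \<open>B R\<close> stand for \<open>B21\<close> and \<open>B12\<close>.\<close>

section \<open>Matrix algebra under equations between dimensions\<close>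

lemma mat_mult_dims [simp]: "dim_row (A * B :: 'a::semiring_0 mat) = dim_row A" "dim_col (A * B) = dim_col B"
  by auto

text \<open>The usual ring laws, conditional on equations between dimensions instead of on membership in
carrier sets. Once the dimensions of the matrices at hand are simplification rules, the simplifier
discharges these conditions and can normalise long products by itself.\<close>
lemma mat_assoc:
  fixes A B C :: "'a::semiring_0 mat"
  assumes "dim_col A = dim_row B" "dim_col B = dim_row C"
  shows "A * B * C = A * (B * C)"
  by (rule assoc_mult_mat[of _ "dim_row A" "dim_row B" _ "dim_row C" _ "dim_col C"]) (use assms in auto)

lemma mat_distrib:
  fixes A B C :: "'a::ring mat"
  shows "\<lbrakk>dim_row A = dim_row B; dim_col A = dim_col B; dim_col A = dim_row C\<rbrakk> \<Longrightarrow> (A + B) * C = A * C + B * C"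
    "\<lbrakk>dim_row A = dim_row B; dim_col A = dim_col B; dim_col C = dim_row A\<rbrakk> \<Longrightarrow> C * (A + B) = C * A + C * B"
    "\<lbrakk>dim_row A = dim_row B; dim_col A = dim_col B; dim_col A = dim_row C\<rbrakk> \<Longrightarrow> (A - B) * C = A * C - B * C"
    "\<lbrakk>dim_row A = dim_row B; dim_col A = dim_col B; dim_col C = dim_row A\<rbrakk> \<Longrightarrow> C * (A - B) = C * A - C * B"
  subgoal by (rule add_mult_distrib_mat[of _ "dim_row A" "dim_col A" _ _ "dim_col C"]) auto
  subgoal by (rule mult_add_distrib_mat[of _ "dim_row C" "dim_row A" _ "dim_col A"]) auto
  subgoal by (rule minus_mult_distrib_mat[of _ "dim_row A" "dim_col A" _ _ "dim_col C"]) auto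
  subgoal by (rule mult_minus_distrib_mat[of _ "dim_row C" "dim_row A" _ "dim_col A"]) auto
  done

lemma mat_units:
  fixes A :: "'a::ring_1 mat"
  shows "dim_row A = n \<Longrightarrow> 1\<^sub>m n * A = A" "dim_col A = n \<Longrightarrow> A * 1\<^sub>m n = A"
    "dim_row A = n \<Longrightarrow> 0\<^sub>m k n * A = 0\<^sub>m k (dim_col A)" "dim_col A = n \<Longrightarrow> A * 0\<^sub>m n k = 0\<^sub>m (dim_row A) k"
    "dim_row A = n \<Longrightarrow> dim_col A = k \<Longrightarrow> A - A = 0\<^sub>m n k"
    "dim_row A = n \<Longrightarrow> dim_col A = k \<Longrightarrow> A - 0\<^sub>m n k = A"
    "dim_row A = n \<Longrightarrow> dim_col A = k \<Longrightarrow> A + 0\<^sub>m n k = A"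
    "dim_row A = n \<Longrightarrow> dim_col A = k \<Longrightarrow> 0\<^sub>m n k + A = A"
  by auto

lemma mat_smult:
  fixes A B :: "'a::comm_ring_1 mat"
  shows "dim_col A = dim_row B \<Longrightarrow> (c \<cdot>\<^sub>m A) * B = c \<cdot>\<^sub>m (A * B)"
    "dim_col A = dim_row B \<Longrightarrow> A * (c \<cdot>\<^sub>m B) = c \<cdot>\<^sub>m (A * B)"
  subgoal by (rule mult_smult_assoc_mat[of _ "dim_row A" "dim_col A" _ "dim_col B"]) auto
  subgoal by (rule mult_smult_distrib[of _ "dim_row A" "dim_col A" _ "dim_col B"]) auto
  done

lemmas mat_ring = mat_assoc mat_distrib mat_units mat_smult

section \<open>Rank through compressions to an identity matrix\<close>

lemma rank_mult_le_left:
  fixes A B :: "'a::field mat"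
  assumes A: "A \<in> carrier_mat n k" and B: "B \<in> carrier_mat k m"
  shows "vec_space.rank n (A * B) \<le> vec_space.rank n A"
proof -
  interpret vec_space "TYPE('a)" n .
  have cA: "set (cols A) \<subseteq> carrier_vec n" using A cols_dim by blast
  have AB: "A * B \<in> carrier_mat n m" using A B by simp
  have cAB: "set (cols (A * B)) \<subseteq> carrier_vec n" using AB cols_dim by blast
  have "set (cols (A * B)) \<subseteq> span (set (cols A))"
  proof
    fix x assume "x \<in> set (cols (A * B))"
    then obtain j where j: "j < m" "x = col (A * B) j"
      using AB by (metis carrier_matD(2) cols_length cols_nth in_set_conv_nth)
    then have "x = A *\<^sub>v col B j" using col_mult2[OF A B j(1)] by (simp only:)
    moreover have "col B j \<in> carrier_vec (dim_col A)" using A B j by auto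
    ultimately show "x \<in> span (set (cols A))"
      using col_space_eq[OF A] unfolding col_space_def A by (metis (mono_tags, lifting) mem_Collect_eq A B carrier_matD mult_mat_vec_carrier col_dim)
  qed
  then have sub: "span (set (cols (A * B))) \<subseteq> span (set (cols A))"
    using cA span_subsetI by blast
  have s1: "subspace class_ring (span (set (cols A))) V"
    and s2: "subspace class_ring (span (set (cols (A * B)))) V"
    using cA cAB span_is_subspace by auto
  show ?thesis unfolding rank_def
    using vectorspace.subspace_dim[OF subspace_is_vs[OF s1] nested_subspaces[OF s1 s2 sub]
        fin_dim_span_cols[OF A]] fin_dim_span_cols[OF AB] by simp
qed

text \<open>The equation \<open>S A T = 1\<close> makes the columns of \<open>A T\<close> linearly independent, because \<open>S\<close> recovers
every coefficient vector \<open>v\<close> from \<open>A T v\<close>. Together with \<open>rank_compression\<close> below it turns the rank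
into the largest size of an identity matrix \<open>S A T\<close>, a description that is symmetric in rows and
columns and concerns only matrix equations.\<close>
lemma compression_le_rank:
  fixes A :: "'a::field mat"
  assumes A: "A \<in> carrier_mat n m" and S: "S \<in> carrier_mat k n" and T: "T \<in> carrier_mat m k"
    and SAT: "S * A * T = 1\<^sub>m k"
  shows "k \<le> vec_space.rank n A"
proof -
  interpret vec_space "TYPE('a)" n .
  note [simp] = carrier_matD[OF A] carrier_matD[OF S] carrier_matD[OF T]
  have AT: "A * T \<in> carrier_mat n k" using A T by simp
  have inj: "v = w" if "v \<in> carrier_vec k" "w \<in> carrier_vec k" "(A * T) *\<^sub>v v = (A * T) *\<^sub>v w" for v w
  proof -
    have "S *\<^sub>v ((A * T) *\<^sub>v x) = x" if "x \<in> carrier_vec k" for x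
      using that SAT S AT by (simp add: mat_assoc flip: assoc_mult_mat_vec)
    then show ?thesis using that by metis
  qed
  have "distinct (cols (A * T))"
    unfolding distinct_conv_nth
  proof (intro allI impI notI)
    fix i j assume ij: "i < length (cols (A * T))" "j < length (cols (A * T))" "i \<noteq> j"
      and eq: "cols (A * T) ! i = cols (A * T) ! j"
    have "S *\<^sub>v col (A * T) l = unit_vec k l" if "l < k" for l
    proof -
      have "S *\<^sub>v col (A * T) l = col (S * (A * T)) l" by (rule col_mult2[OF S AT that, symmetric])
      also have "\<dots> = unit_vec k l" using SAT that by (simp add: mat_assoc)
      finally show ?thesis .
    qed
    then have "unit_vec k i = (unit_vec k j :: 'a vec)" using ij eq by (metis AT carrier_matD(2) cols_length cols_nth)
    then show False using ij by (metis cols_length AT carrier_matD(2) index_unit_vec(1) zero_neq_one)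
  qed
  moreover have "\<not> lin_dep (set (cols (A * T)))"
  proof
    assume dep: "lin_dep (set (cols (A * T)))"
    obtain v where v: "v \<in> carrier_vec k" "v \<noteq> 0\<^sub>v k" "(A * T) *\<^sub>v v = 0\<^sub>v n"
      using lin_depE[OF AT dep calculation] by blast
    have "(A * T) *\<^sub>v 0\<^sub>v k = 0\<^sub>v n" using AT by (intro eq_vecI) auto
    then show False using inj[of v "0\<^sub>v k"] v by simp
  qed
  ultimately have "k = rank (A * T)" using lin_indpt_full_rank[OF AT] by simp
  also have "\<dots> \<le> rank A" using rank_mult_le_left[OF A T] .
  finally show ?thesis .
qed

text \<open>Stacking \<open>S1\<close> on \<open>S2\<close> and putting \<open>T1\<close> next to \<open>T2\<close> yields a block matrix with diagonal blocks
\<open>1\<close> and off-diagonal blocks \<open>0\<close>.\<close>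
lemma join_compressions:
  fixes A :: "'a::ring_1 mat"
  assumes A: "A \<in> carrier_mat n m"
    and S1: "S1 \<in> carrier_mat k n" and T1: "T1 \<in> carrier_mat m k" and 11: "S1 * A * T1 = 1\<^sub>m k"
    and S2: "S2 \<in> carrier_mat l n" and T2: "T2 \<in> carrier_mat m l" and 22: "S2 * A * T2 = 1\<^sub>m l"
    and 12: "S1 * A * T2 = 0\<^sub>m k l" and 21: "S2 * A * T1 = 0\<^sub>m l k"
  shows "\<exists>S T. S \<in> carrier_mat (k + l) n \<and> T \<in> carrier_mat m (k + l) \<and> S * A * T = 1\<^sub>m (k + l)"
proof -
  define S where "S = four_block_mat S1 (0\<^sub>m k 0) S2 (0\<^sub>m l 0)"
  define T where "T = four_block_mat T1 T2 (0\<^sub>m 0 k) (0\<^sub>m 0 l)"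
  define A' where "A' = four_block_mat A (0\<^sub>m n 0) (0\<^sub>m 0 m) (0\<^sub>m 0 0)"
  note [simp] = carrier_matD[OF A] carrier_matD[OF S1] carrier_matD[OF T1] carrier_matD[OF S2] carrier_matD[OF T2]
  \<comment> \<open>Product formulas for block matrices need a two by two block shape, so \<open>A\<close> gets empty blocks.\<close>
  have A': "A' = A" unfolding A'_def by (rule eq_matI) (auto)
  have "S * A' = four_block_mat (S1 * A) (0\<^sub>m k 0) (S2 * A) (0\<^sub>m l 0)"
    unfolding S_def A'_def by (subst mult_four_block_mat[OF S1 _ S2 _ A]) (auto simp: mat_units)
  moreover have "\<dots> * T = four_block_mat (S1 * A * T1) (S1 * A * T2) (S2 * A * T1) (S2 * A * T2)"
    unfolding T_def 
    by (subst mult_four_block_mat[of _ k m _ 0 _ l _ _ k _ l]) (use A S1 S2 T1 T2 in \<open>auto simp: mat_units\<close>)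
  ultimately have "S * A * T = 1\<^sub>m (k + l)" unfolding A' 11 12 21 22 by simp
  moreover have "S \<in> carrier_mat (k + l) n" "T \<in> carrier_mat m (k + l)"
    unfolding S_def T_def by (auto intro!: carrier_matI)
  ultimately show ?thesis by blast
qed

text \<open>Wedderburn rank reduction: \<open>A - A T S A\<close> is annihilated by \<open>S\<close> on the left and by \<open>T\<close> on the right,
so a nonzero entry of it gives a compression of size \<open>1\<close> that can be joined to the given one.\<close>
lemma maximal_compression:
  fixes A :: "'a::field mat"
  assumes A: "A \<in> carrier_mat n m" and S: "S \<in> carrier_mat k n" and T: "T \<in> carrier_mat m k"
    and SAT: "S * A * T = 1\<^sub>m k"
    and max: "\<And>S' T'. S' \<in> carrier_mat (Suc k) n \<Longrightarrow> T' \<in> carrier_mat m (Suc k) \<Longrightarrow> S' * A * T' \<noteq> 1\<^sub>m (Suc k)"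
  shows "A * T * S * A = A"
proof (rule ccontr)
  note [simp] = carrier_matD[OF A] carrier_matD[OF S] carrier_matD[OF T]
  define M where "M = A - A * T * S * A"
  assume "A * T * S * A \<noteq> A"
  moreover have "A * T * S * A = A" if "\<And>i j. i < n \<Longrightarrow> j < m \<Longrightarrow> M $$ (i, j) = 0"
    using that unfolding M_def by (intro eq_matI) auto
  ultimately obtain i j where ij: "i < n" "j < m" and c: "M $$ (i, j) \<noteq> 0" by blast
  define u where "u = mat 1 n (\<lambda>(a, b). if b = i then 1 / M $$ (i, j) else 0)"
  define v where "v = mat m 1 (\<lambda>(a, b). if a = j then (1 :: 'a) else 0)"
  have [simp]: "dim_row u = 1" "dim_col u = n" "dim_row v = m" "dim_col v = 1" "dim_row M = n" "dim_col M = m"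
    unfolding u_def v_def M_def by auto
  have "(u * M) $$ (0, b) = M $$ (i, b) / M $$ (i, j)" if "b < m" for b
    using ij that by (simp add: scalar_prod_def u_def if_distrib[of "\<lambda>x. x * _"] cong: if_cong)
  then have uMv: "u * M * v = 1\<^sub>m 1"
    using ij c by (intro eq_matI) (auto simp: scalar_prod_def v_def if_distrib[of "\<lambda>x. _ * x"] cong: if_cong)
  have SAT': "S * (A * T) = 1\<^sub>m k" using SAT by (simp add: mat_ring)
  have SATX: "S * (A * (T * X)) = X" if "dim_row X = k" for X
    using SAT' that by (simp add: mat_units flip: mat_assoc)
  define S2 where "S2 = u - u * A * T * S"
  define T2 where "T2 = v - T * S * A * v"
  have cS2: "S2 \<in> carrier_mat 1 n" and cT2: "T2 \<in> carrier_mat m 1" unfolding S2_def T2_def by (auto intro!: carrier_matI)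
  have 1: "S * A * T2 = 0\<^sub>m k 1" unfolding T2_def by (simp add: mat_ring SATX)
  have 2: "S2 * A * T = 0\<^sub>m 1 k" unfolding S2_def by (simp add: mat_ring SAT')
  have "S2 * A * T2 = u * M * v" using 2 unfolding T2_def S2_def M_def 
    by (simp add: mat_ring SATX)
  then have 3: "S2 * A * T2 = 1\<^sub>m 1" using uMv by simp
  show False
    using join_compressions[OF A S T SAT cS2 cT2 3 1 2] max by auto
qed

lemma rank_compression:
  fixes A :: "'a::field mat"
  assumes A: "A \<in> carrier_mat n m"
  obtains S T where "S \<in> carrier_mat (vec_space.rank n A) n" "T \<in> carrier_mat m (vec_space.rank n A)"
    "S * A * T = 1\<^sub>m (vec_space.rank n A)" "A * T * S * A = A"
proof -
  define P where "P k \<longleftrightarrow> (\<exists>S T. S \<in> carrier_mat k n \<and> T \<in> carrier_mat m k \<and> S * A * T = 1\<^sub>m k)" for k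
  have "P 0" unfolding P_def
    by (rule exI[of _ "0\<^sub>m 0 n"], rule exI[of _ "0\<^sub>m m 0"]) auto
  moreover have "P k \<Longrightarrow> k \<le> vec_space.rank n A" for k
    unfolding P_def using compression_le_rank[OF A] by blast
  ultimately obtain k where k: "P k" and max: "\<And>l. P l \<Longrightarrow> l \<le> k"
    using Nat.ex_has_greatest_nat[of P 0 "vec_space.rank n A"] by blast
  from k obtain S T where S: "S \<in> carrier_mat k n" and T: "T \<in> carrier_mat m k"
    and SAT: "S * A * T = 1\<^sub>m k" unfolding P_def by blast
  have ATSA: "A * T * S * A = A"
    using max[of "Suc k"] unfolding P_def by (intro maximal_compression[OF A S T SAT]) auto
  have AT: "A * T \<in> carrier_mat n k" and SA: "S * A \<in> carrier_mat k m" using A S T by auto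
  have "vec_space.rank n A = vec_space.rank n ((A * T) * (S * A))"
    using ATSA A S T by (simp add: mat_assoc)
  also have "\<dots> \<le> vec_space.rank n (A * T)" using rank_mult_le_left[OF AT SA] .
  also have "\<dots> \<le> k" using vec_space.rank_le_nc[OF AT] .
  finally have "vec_space.rank n A = k" using compression_le_rank[OF A S T SAT] by simp
  then show thesis using that S T SAT ATSA by blast
qed

text \<open>By \<open>rank_compression\<close>, \<open>B\<close> factors through a space whose dimension is the rank of \<open>B\<close>, hence so
does \<open>A B\<close>.\<close>
lemma rank_mult_le_right:
  fixes A B :: "'a::field mat"
  assumes A: "A \<in> carrier_mat n k" and B: "B \<in> carrier_mat k m"
  shows "vec_space.rank n (A * B) \<le> vec_space.rank k B"
proof -
  obtain S T where S: "S \<in> carrier_mat (vec_space.rank k B) k" and T: "T \<in> carrier_mat m (vec_space.rank k B)"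
    and BTSB: "B * T * S * B = B" using rank_compression[OF B] by metis
  have ABT: "A * B * T \<in> carrier_mat n (vec_space.rank k B)" and SB: "S * B \<in> carrier_mat (vec_space.rank k B) m"
    using A B S T by auto
  have "A * B = (A * B * T) * (S * B)" using BTSB A B S T by (simp add: mat_assoc)
  then show ?thesis
    using rank_mult_le_left[OF ABT SB] vec_space.rank_le_nc[OF ABT] by simp
qed

lemma compression_of_rank_size:
  fixes A :: "'a::field mat"
  assumes A: "A \<in> carrier_mat n m" and S: "S \<in> carrier_mat k n" and T: "T \<in> carrier_mat m k"
    and SAT: "S * A * T = 1\<^sub>m k" and "vec_space.rank n A \<le> k"
  shows "A * T * S * A = A"
  using maximal_compression[OF A S T SAT] compression_le_rank[OF A] assms(5) by (metis not_less_eq_eq order.trans)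

text \<open>A compression of \<open>A\<close> and one of \<open>B\<close> are both compressions of the identity matrix between the two
factors. After the column part of the first is corrected by a projection they can be joined, and
the joined one has size at most \<open>k\<close>.\<close>
lemma sylvester_rank_le:
  fixes A B :: "'a::field mat"
  assumes A: "A \<in> carrier_mat n k" and B: "B \<in> carrier_mat k m" and AB: "A * B = 0\<^sub>m n m"
  shows "vec_space.rank n A + vec_space.rank k B \<le> k"
proof -
  obtain S1 T1 where S1: "S1 \<in> carrier_mat (vec_space.rank n A) n" and T1: "T1 \<in> carrier_mat k (vec_space.rank n A)"
    and 1: "S1 * A * T1 = 1\<^sub>m (vec_space.rank n A)" using rank_compression[OF A] by metis
  obtain S2 T2 where S2: "S2 \<in> carrier_mat (vec_space.rank k B) k" and T2: "T2 \<in> carrier_mat m (vec_space.rank k B)"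
    and 2: "S2 * B * T2 = 1\<^sub>m (vec_space.rank k B)" using rank_compression[OF B] by metis
  note [simp] = carrier_matD[OF A] carrier_matD[OF B] carrier_matD[OF S1] carrier_matD[OF T1] carrier_matD[OF S2] carrier_matD[OF T2]
  \<comment> \<open>\<open>B T2 S2\<close> is a projection killed by \<open>A\<close>; removing it from \<open>T1\<close> makes the off-diagonal \<open>S2 T\<close> vanish.\<close>
  define S T where "S = S1 * A" and "T = T1 - B * T2 * S2 * T1"
  have 22: "S2 * (B * T2) = 1\<^sub>m (vec_space.rank k B)" using 2 by (simp add: mat_ring)
  have D22X: "S2 * (B * (T2 * X)) = X" if "dim_row X = vec_space.rank k B" for X
    using 22 that by (simp add: mat_units flip: mat_assoc)
  have AB': "A * (B * X) = 0\<^sub>m n (dim_col X)" if "dim_row X = m" for X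
    using AB that by (simp add: mat_units flip: mat_assoc)
  have c: "S \<in> carrier_mat (vec_space.rank n A) k" "T \<in> carrier_mat k (vec_space.rank n A)" "B * T2 \<in> carrier_mat k (vec_space.rank k B)"
    unfolding S_def T_def by (auto intro!: carrier_matI)
  have "S * 1\<^sub>m k * T = 1\<^sub>m (vec_space.rank n A)" using 1 unfolding S_def T_def by (simp add: mat_ring AB')
  moreover have "S2 * 1\<^sub>m k * (B * T2) = 1\<^sub>m (vec_space.rank k B)" using 22 by (simp add: mat_ring)
  moreover have "S * 1\<^sub>m k * (B * T2) = 0\<^sub>m (vec_space.rank n A) (vec_space.rank k B)" unfolding S_def by (simp add: mat_ring AB')
  moreover have "S2 * 1\<^sub>m k * T = 0\<^sub>m (vec_space.rank k B) (vec_space.rank n A)" unfolding T_def by (simp add: mat_ring D22X)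
  ultimately obtain S' T' where "S' \<in> carrier_mat (vec_space.rank n A + vec_space.rank k B) k"
    "T' \<in> carrier_mat k (vec_space.rank n A + vec_space.rank k B)"
    "S' * (1\<^sub>m k :: 'a mat) * T' = 1\<^sub>m (vec_space.rank n A + vec_space.rank k B)"
    using join_compressions[OF one_carrier_mat c(1,2) _ S2 c(3)] by blast
  then have "vec_space.rank n A + vec_space.rank k B \<le> vec_space.rank k (1\<^sub>m k :: 'a mat)"
    using compression_le_rank[OF one_carrier_mat] by blast
  also have "\<dots> \<le> k" by (rule vec_space.rank_le_nc) auto
  finally show ?thesis .
qed

section \<open>Pencils of matrices\<close>

interpretation eval_hom: comm_ring_hom "\<lambda>f. poly f x" for x :: "'a::comm_ring_1"
  by unfold_locales auto

lemma mat_smult_smult: "x \<cdot>\<^sub>m (y \<cdot>\<^sub>m A) = (x * y) \<cdot>\<^sub>m A" for A :: "'a::semigroup_mult mat"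
  by (intro eq_matI) (auto simp: mult.assoc)

text \<open>\<open>N\<close> is the adjugate of \<open>1 + x E\<close> and \<open>\<delta>\<close> its determinant, both computed over the polynomial
ring. Thus \<open>1 + x E\<close> is inverted by \<open>N / \<delta>\<close> outside the finitely many roots of \<open>\<delta>\<close>, and the
dependence on \<open>x\<close> is polynomial up to the factor \<open>\<delta>\<close>.\<close>
lemma pencil_adjugate:
  fixes E :: "'a::field mat"
  assumes E: "E \<in> carrier_mat k k"
  obtains N :: "'a poly mat" and \<delta> :: "'a poly" where "N \<in> carrier_mat k k" "poly \<delta> 0 = 1"
    "\<And>x. (1\<^sub>m k + x \<cdot>\<^sub>m E) * map_mat (\<lambda>f. poly f x) N = poly \<delta> x \<cdot>\<^sub>m 1\<^sub>m k"
proof -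
  define D where "D = mat k k (\<lambda>(i, j). [: 1\<^sub>m k $$ (i, j), E $$ (i, j) :])"
  have D: "D \<in> carrier_mat k k" unfolding D_def by simp
  have ev: "map_mat (\<lambda>f. poly f x) D = 1\<^sub>m k + x \<cdot>\<^sub>m E" for x
    using E unfolding D_def by (intro eq_matI) auto
  show thesis
  proof (rule that[of "adj_mat D" "det D"])
    show "adj_mat D \<in> carrier_mat k k" by (rule adj_mat(1)[OF D])
    have "poly (det D) 0 = det (map_mat (\<lambda>f. poly f 0) D)" by (simp add: eval_hom.hom_det)
    also have "\<dots> = 1" unfolding ev
    proof -
      have "1\<^sub>m k + 0 \<cdot>\<^sub>m E = 1\<^sub>m k" using E by (intro eq_matI) auto
      then show "det (1\<^sub>m k + 0 \<cdot>\<^sub>m E) = 1" by simp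
    qed
    finally show "poly (det D) 0 = 1" .
    fix x :: 'a
    have "map_mat (\<lambda>f. poly f x) (D * adj_mat D) = map_mat (\<lambda>f. poly f x) (det D \<cdot>\<^sub>m 1\<^sub>m k)"
      by (simp add: adj_mat(2)[OF D])
    moreover have "map_mat (\<lambda>f. poly f x) (det D \<cdot>\<^sub>m 1\<^sub>m k) = poly (det D) x \<cdot>\<^sub>m 1\<^sub>m k"
      by (intro eq_matI) auto
    ultimately show "(1\<^sub>m k + x \<cdot>\<^sub>m E) * map_mat (\<lambda>f. poly f x) (adj_mat D) = poly (det D) x \<cdot>\<^sub>m 1\<^sub>m k"
      by (simp add: eval_hom.mat_hom_mult[OF D adj_mat(1)[OF D]] ev)
  qed
qed

text \<open>A compression of \<open>A\<close> deforms to a compression of \<open>A + x B\<close> of the same size for all but finitely many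
\<open>x\<close>, with the same \<open>S\<close> and with \<open>T\<close> corrected by \<open>N / \<delta>\<close>.\<close>
lemma compression_pencil:
  fixes A B :: "'a::field mat"
  assumes A: "A \<in> carrier_mat n m" and B: "B \<in> carrier_mat n m"
    and S: "S \<in> carrier_mat k n" and T: "T \<in> carrier_mat m k" and SAT: "S * A * T = 1\<^sub>m k"
  obtains N :: "'a poly mat" and \<delta> :: "'a poly" where "N \<in> carrier_mat k k" "poly \<delta> 0 = 1"
    "map_mat (\<lambda>f. poly f 0) N = 1\<^sub>m k"
    "\<And>x. poly \<delta> x \<noteq> 0 \<Longrightarrow>
      S * (A + x \<cdot>\<^sub>m B) * (T * (inverse (poly \<delta> x) \<cdot>\<^sub>m map_mat (\<lambda>f. poly f x) N)) = 1\<^sub>m k"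
proof -
  note [simp] = carrier_matD[OF A] carrier_matD[OF B] carrier_matD[OF S] carrier_matD[OF T]
  have E: "S * B * T \<in> carrier_mat k k" using S B T by simp
  obtain N \<delta> where N: "N \<in> carrier_mat k k" and \<delta>: "poly \<delta> 0 = 1"
    and inv: "\<And>x. (1\<^sub>m k + x \<cdot>\<^sub>m (S * B * T)) * map_mat (\<lambda>f. poly f x) N = poly \<delta> x \<cdot>\<^sub>m 1\<^sub>m k"
    using pencil_adjugate[OF E] by metis
  note [simp] = carrier_matD[OF N]
  have "1\<^sub>m k + 0 \<cdot>\<^sub>m (S * B * T) = 1\<^sub>m k" by (intro eq_matI) auto
  moreover have "1 \<cdot>\<^sub>m 1\<^sub>m k = (1\<^sub>m k :: 'a mat)" by (intro eq_matI) auto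
  ultimately have "1\<^sub>m k * map_mat (\<lambda>f. poly f 0) N = 1\<^sub>m k" using inv[of 0] \<delta> by simp
  then have "map_mat (\<lambda>f. poly f 0) N = 1\<^sub>m k" by (simp add: mat_units)
  moreover have "S * (A + x \<cdot>\<^sub>m B) * (T * (inverse (poly \<delta> x) \<cdot>\<^sub>m map_mat (\<lambda>f. poly f x) N)) = 1\<^sub>m k"
    if "poly \<delta> x \<noteq> 0" for x
  proof -
    have "S * (A + x \<cdot>\<^sub>m B) * T = 1\<^sub>m k + x \<cdot>\<^sub>m (S * B * T)"
      using SAT by (simp add: mat_ring)
    then have "S * (A + x \<cdot>\<^sub>m B) * (T * (inverse (poly \<delta> x) \<cdot>\<^sub>m map_mat (\<lambda>f. poly f x) N))
      = inverse (poly \<delta> x) \<cdot>\<^sub>m ((1\<^sub>m k + x \<cdot>\<^sub>m (S * B * T)) * map_mat (\<lambda>f. poly f x) N)"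
      by (simp add: mat_smult flip: mat_assoc)
    also have "\<dots> = 1\<^sub>m k" unfolding inv using that by (intro eq_matI) auto
    finally show ?thesis .
  qed
  ultimately show thesis using that N \<delta> by blast
qed

lemma finite_rank_drop:
  fixes A B :: "'a::field mat"
  assumes A: "A \<in> carrier_mat n m" and B: "B \<in> carrier_mat n m"
  shows "finite {x. vec_space.rank n (A + x \<cdot>\<^sub>m B) < vec_space.rank n A}"
proof -
  obtain S T where S: "S \<in> carrier_mat (vec_space.rank n A) n" and T: "T \<in> carrier_mat m (vec_space.rank n A)"
    and SAT: "S * A * T = 1\<^sub>m (vec_space.rank n A)" using rank_compression[OF A] by metis
  obtain N :: "'a poly mat" and \<delta> where N: "N \<in> carrier_mat (vec_space.rank n A) (vec_space.rank n A)" and \<delta>: "poly \<delta> 0 = 1"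
    and inv: "\<And>x. poly \<delta> x \<noteq> 0 \<Longrightarrow>
      S * (A + x \<cdot>\<^sub>m B) * (T * (inverse (poly \<delta> x) \<cdot>\<^sub>m map_mat (\<lambda>f. poly f x) N)) = 1\<^sub>m (vec_space.rank n A)"
    using compression_pencil[OF A B S T SAT] by metis
  have "{x. vec_space.rank n (A + x \<cdot>\<^sub>m B) < vec_space.rank n A} \<subseteq> {x. poly \<delta> x = 0}"
  proof safe
    fix x assume less: "vec_space.rank n (A + x \<cdot>\<^sub>m B) < vec_space.rank n A"
    show "poly \<delta> x = 0"
    proof (rule ccontr)
      assume nz: "poly \<delta> x \<noteq> 0"
      have "A + x \<cdot>\<^sub>m B \<in> carrier_mat n m"
        "T * (inverse (poly \<delta> x) \<cdot>\<^sub>m map_mat (\<lambda>f. poly f x) N) \<in> carrier_mat m (vec_space.rank n A)"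
        using A B T N by auto
      from compression_le_rank[OF this(1) S this(2) inv[OF nz]] less show False by simp
    qed
  qed
  moreover have "\<delta> \<noteq> 0" using \<delta> by auto
  ultimately show ?thesis using poly_roots_finite finite_subset by blast
qed

text \<open>For \<open>x \<noteq> 0\<close> the matrices \<open>x A + B\<close> and \<open>A + B / x\<close> have the same rank, so \<open>finite_rank_drop\<close>
applies to \<open>1 / x\<close>. The two lemmas together let one member of a pencil be generic with respect to
both of its end points.\<close>
lemma finite_rank_drop_at_infinity:
  fixes A B :: "'a::field mat"
  assumes A: "A \<in> carrier_mat n m" and B: "B \<in> carrier_mat n m"
  shows "finite {x. vec_space.rank n (x \<cdot>\<^sub>m A + B) < vec_space.rank n A}"
proof -
  have sub: "{x. vec_space.rank n (x \<cdot>\<^sub>m A + B) < vec_space.rank n A}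
    \<subseteq> insert 0 (inverse ` {x. vec_space.rank n (A + x \<cdot>\<^sub>m B) < vec_space.rank n A})"
  proof safe
    fix x assume less: "vec_space.rank n (x \<cdot>\<^sub>m A + B) < vec_space.rank n A"
      and *: "x \<notin> inverse ` {x. vec_space.rank n (A + x \<cdot>\<^sub>m B) < vec_space.rank n A}"
    show "x = 0"
    proof (rule ccontr)
      assume x: "x \<noteq> 0"
      have "A + inverse x \<cdot>\<^sub>m B = (inverse x \<cdot>\<^sub>m 1\<^sub>m n) * (x \<cdot>\<^sub>m A + B)"
        using x A B by (simp add: mat_smult mat_units) (intro eq_matI; simp add: field_simps)
      then have "vec_space.rank n (A + inverse x \<cdot>\<^sub>m B) \<le> vec_space.rank n (x \<cdot>\<^sub>m A + B)"
        using rank_mult_le_right[of "inverse x \<cdot>\<^sub>m 1\<^sub>m n" n n "x \<cdot>\<^sub>m A + B" m] A B by simp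
      with less have "inverse x \<in> {x. vec_space.rank n (A + x \<cdot>\<^sub>m B) < vec_space.rank n A}" by simp
      then have "inverse (inverse x) \<in> inverse ` {x. vec_space.rank n (A + x \<cdot>\<^sub>m B) < vec_space.rank n A}" by (rule imageI)
      with * show False by simp
    qed
  qed
  show ?thesis using finite_rank_drop[OF A B] by (intro finite_subset[OF sub]) auto
qed

lemma poly_eq_0_if_infinite:
  fixes f :: "'a::idom poly"
  assumes "infinite (UNIV :: 'a set)" "\<And>x. poly f x = 0"
  shows "f = 0"
  using poly_roots_finite[of f] assms by auto

text \<open>In coordinates in which \<open>A\<close> is the block matrix with blocks \<open>1, 0, 0, 0\<close>, the two conclusions say that
the lower right block \<open>B22\<close> vanishes and that \<open>B21 B12 = 0\<close>; here \<open>L A = 0\<close> and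
\<open>A R = 0\<close> mean that \<open>L\<close> looks only at the lower rows and \<open>R\<close> only at the right columns. Since \<open>M = A + x B\<close> has rank at most \<open>k\<close>, the deformed compression
\<open>S, T D\<close> of \<open>M\<close> has full size, whence \<open>M = M (T D) S M\<close>. Multiplying by \<open>L\<close> and \<open>R\<close>
removes the outer contributions of \<open>A\<close> and leaves \<open>x L B R = x\<^sup>2 (L B T) D (S B R)\<close>. Clearing the denominator \<open>\<delta>\<close> gives an
identity between polynomials in \<open>x\<close>, whose two lowest coefficients yield the claims. Infinitely
many scalars are needed to pass from values to coefficients.\<close>
lemma maximal_rank_pencil:
  fixes A B :: "'a::field mat"
  assumes inf: "infinite (UNIV :: 'a set)"
    and A: "A \<in> carrier_mat n m" and B: "B \<in> carrier_mat n m"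
    and S: "S \<in> carrier_mat k n" and T: "T \<in> carrier_mat m k" and SAT: "S * A * T = 1\<^sub>m k"
    and bound: "\<And>x. vec_space.rank n (A + x \<cdot>\<^sub>m B) \<le> k"
    and L: "L \<in> carrier_mat a n" and R: "R \<in> carrier_mat m b"
    and LA: "L * A = 0\<^sub>m a m" and AR: "A * R = 0\<^sub>m n b"
  shows "L * B * R = 0\<^sub>m a b" "(L * B * T) * (S * B * R) = 0\<^sub>m a b"
proof -
  note [simp] = carrier_matD[OF A] carrier_matD[OF B] carrier_matD[OF S] carrier_matD[OF T] carrier_matD[OF L] carrier_matD[OF R]
  obtain N :: "'a poly mat" and \<delta> where N: "N \<in> carrier_mat k k" and \<delta>: "poly \<delta> 0 = 1"
    and N0: "map_mat (\<lambda>f. poly f 0) N = 1\<^sub>m k"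
    and inv: "\<And>x. poly \<delta> x \<noteq> 0 \<Longrightarrow>
      S * (A + x \<cdot>\<^sub>m B) * (T * (inverse (poly \<delta> x) \<cdot>\<^sub>m map_mat (\<lambda>f. poly f x) N)) = 1\<^sub>m k"
    using compression_pencil[OF A B S T SAT] by metis
  note [simp] = carrier_matD[OF N]
  define X Y where "X = L * B * T" and "Y = S * B * R"
  have [simp]: "dim_row X = a" "dim_col X = k" "dim_row Y = k" "dim_col Y = b" unfolding X_def Y_def by auto
  have cX: "X \<in> carrier_mat a k" and cY: "Y \<in> carrier_mat k b" by (auto intro!: carrier_matI)
  have LAX: "L * (A * Z) = 0\<^sub>m a (dim_col Z)" if "dim_row Z = m" for Z
    using LA that by (simp add: mat_units flip: mat_assoc)
  have eq: "(poly \<delta> x * x) \<cdot>\<^sub>m (L * B * R) = (x * x) \<cdot>\<^sub>m (X * map_mat (\<lambda>f. poly f x) N * Y)"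
    if nz: "poly \<delta> x \<noteq> 0" for x
  proof -
    define M where "M = A + x \<cdot>\<^sub>m B"
    define D where "D = inverse (poly \<delta> x) \<cdot>\<^sub>m map_mat (\<lambda>f. poly f x) N"
    have [simp]: "dim_row M = n" "dim_col M = m" "dim_row D = k" "dim_col D = k" unfolding M_def D_def by auto
    have M: "M \<in> carrier_mat n m" and TD: "T * D \<in> carrier_mat m k" by (auto intro!: carrier_matI)
    have "M * (T * D) * S * M = M"
      using compression_of_rank_size[OF M S TD] inv[OF nz] bound[of x] unfolding M_def D_def by blast
    then have "L * M * R = (L * M * T) * D * (S * M * R)"
      by (metis (no_types, lifting) mat_assoc mat_mult_dims \<open>dim_row M = n\<close> \<open>dim_col M = m\<close> \<open>dim_row D = k\<close> \<open>dim_col D = k\<close> carrier_matD L R S T)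
    moreover have "L * M * R = x \<cdot>\<^sub>m (L * B * R)" unfolding M_def by (simp add: mat_ring LAX)
    moreover have "L * M * T = x \<cdot>\<^sub>m X" unfolding M_def X_def by (simp add: mat_ring LAX)
    moreover have "S * M * R = x \<cdot>\<^sub>m Y" unfolding M_def Y_def by (simp add: mat_ring AR)
    ultimately have "x \<cdot>\<^sub>m (L * B * R) = (x * x * inverse (poly \<delta> x)) \<cdot>\<^sub>m (X * map_mat (\<lambda>f. poly f x) N * Y)"
      unfolding D_def by (simp add: mat_ring) (intro eq_matI; simp)
    then have "poly \<delta> x \<cdot>\<^sub>m (x \<cdot>\<^sub>m (L * B * R)) = poly \<delta> x \<cdot>\<^sub>m ((x * x * inverse (poly \<delta> x)) \<cdot>\<^sub>m (X * map_mat (\<lambda>f. poly f x) N * Y))"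
      by simp
    moreover have "poly \<delta> x * (x * x * inverse (poly \<delta> x)) = x * x" using nz by simp
    ultimately show ?thesis by (simp only: mat_smult_smult)
  qed
  have entry: "(L * B * R) $$ (i, j) = 0 \<and> (X * Y) $$ (i, j) = 0" if ij: "i < a" "j < b" for i j
  proof -
    let ?C = "map_mat (\<lambda>c. [:c:])"
    define e where "e = (L * B * R) $$ (i, j)"
    define g where "g = (?C X * N * ?C Y) $$ (i, j)"
    have ev: "poly g x = (X * map_mat (\<lambda>f. poly f x) N * Y) $$ (i, j)" for x
    proof -
      have C: "map_mat (\<lambda>f. poly f x) (?C Z) = Z" for Z :: "'a mat" by (intro eq_matI) auto
      have "poly g x = map_mat (\<lambda>f. poly f x) (?C X * N * ?C Y) $$ (i, j)"
        using ij unfolding g_def by simp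
      also have "map_mat (\<lambda>f. poly f x) (?C X * N * ?C Y) = X * map_mat (\<lambda>f. poly f x) N * Y"
        by (subst eval_hom.mat_hom_mult[of _ a k _ b], use cX cY N in simp, use cY in simp,
            subst eval_hom.mat_hom_mult[of _ a k _ k], use cX in simp, use N in simp) (simp only: C)
      finally show ?thesis .
    qed
    \<comment> \<open>The extra factor \<open>\<delta>\<close> below makes the product vanish also at the excluded points.\<close>
    define f where "f = [:0, 1:] * (Polynomial.smult e \<delta> - [:0, 1:] * g)"
    have "poly (\<delta> * f) x = 0" for x
    proof (cases "poly \<delta> x = 0")
      case False
      have "((poly \<delta> x * x) \<cdot>\<^sub>m (L * B * R)) $$ (i, j) = ((x * x) \<cdot>\<^sub>m (X * map_mat (\<lambda>f. poly f x) N * Y)) $$ (i, j)"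
        by (simp only: eq[OF False])
      then have "poly \<delta> x * x * e = x * x * poly g x" using ij unfolding ev e_def by simp
      then show ?thesis unfolding f_def by (auto simp: algebra_simps)
    qed simp
    then have "\<delta> * f = 0" by (rule poly_eq_0_if_infinite[OF inf])
    moreover have "\<delta> \<noteq> 0" using \<delta> by auto
    ultimately have fac: "Polynomial.smult e \<delta> = [:0, 1:] * g" unfolding f_def by auto
    then have "poly (Polynomial.smult e \<delta>) 0 = poly ([:0, 1:] * g) 0" by simp
    then have e: "e = 0" using \<delta> by simp
    then have "g = 0" using fac by simp
    then have "(X * 1\<^sub>m k * Y) $$ (i, j) = 0" using ev[of 0] N0 by simp
    then show ?thesis using e unfolding e_def by (simp add: mat_units)
  qed
  show "L * B * R = 0\<^sub>m a b" using entry by (intro eq_matI) auto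
  show "(L * B * T) * (S * B * R) = 0\<^sub>m a b" using entry unfolding X_def[symmetric] Y_def[symmetric]
    by (intro eq_matI) auto
qed

section \<open>Kronecker products and blow-ups\<close>

lemma kronecker_prod_dims [simp]:
  "dim_row (kronecker_prod A B) = dim_row A * dim_row B"
  "dim_col (kronecker_prod A B) = dim_col A * dim_col B"
  by (simp_all add: kronecker_prod_def)

lemma kronecker_prod_carrier:
  "A \<in> carrier_mat p q \<Longrightarrow> B \<in> carrier_mat a b \<Longrightarrow> kronecker_prod A B \<in> carrier_mat (p * a) (q * b)"
  by (auto intro!: carrier_matI)

lemma sum_div_mod:
  fixes f :: "nat \<Rightarrow> nat \<Rightarrow> 'a::comm_monoid_add"
  shows "(\<Sum>k<q * b. f (k div b) (k mod b)) = (\<Sum>x<q. \<Sum>y<b. f x y)"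
proof -
  have "(\<Sum>k = x * b..<x * b + b. f (k div b) (k mod b)) = (\<Sum>y<b. f x y)" for x
    unfolding sum.atLeastLessThan_shift_0[of _ "x * b"] by (auto simp: atLeast0LessThan intro!: sum.cong)
  then show ?thesis by (simp flip: sum.nat_group)
qed

lemma kronecker_prod_mult:
  fixes A B C D :: "'a::comm_ring_1 mat"
  assumes "dim_col A = dim_row C" "dim_col B = dim_row D"
  shows "kronecker_prod A B * kronecker_prod C D = kronecker_prod (A * C) (B * D)"
proof (rule eq_matI)
  fix i j assume "i < dim_row (kronecker_prod (A * C) (B * D))" "j < dim_col (kronecker_prod (A * C) (B * D))"
  then have ij: "i < dim_row A * dim_row B" "j < dim_col C * dim_col D" by auto
  then have pos: "dim_row B > 0" "dim_col D > 0" by (auto intro: Nat.gr0I)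
  have idx: "i div dim_row B < dim_row A" "j div dim_col D < dim_col C" "i mod dim_row B < dim_row B" "j mod dim_col D < dim_col D"
    using ij pos by (auto intro: less_mult_imp_div_less)
  have "(kronecker_prod A B * kronecker_prod C D) $$ (i, j) = (\<Sum>k<dim_row C * dim_row D.
    A $$ (i div dim_row B, k div dim_row D) * B $$ (i mod dim_row B, k mod dim_row D)
      * (C $$ (k div dim_row D, j div dim_col D) * D $$ (k mod dim_row D, j mod dim_col D)))"
    using ij assms by (simp add: scalar_prod_def kronecker_prod_def atLeast0LessThan)
  also have "\<dots> = (\<Sum>x<dim_row C. \<Sum>y<dim_row D. A $$ (i div dim_row B, x) * B $$ (i mod dim_row B, y)
      * (C $$ (x, j div dim_col D) * D $$ (y, j mod dim_col D)))"
    by (rule sum_div_mod)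
  also have "\<dots> = (\<Sum>x<dim_row C. A $$ (i div dim_row B, x) * C $$ (x, j div dim_col D))
      * (\<Sum>y<dim_row D. B $$ (i mod dim_row B, y) * D $$ (y, j mod dim_col D))"
    unfolding sum_product by (intro sum.cong refl) (simp add: ac_simps)
  also have "\<dots> = kronecker_prod (A * C) (B * D) $$ (i, j)"
    using ij idx assms by (simp add: kronecker_prod_def scalar_prod_def atLeast0LessThan)
  finally show "(kronecker_prod A B * kronecker_prod C D) $$ (i, j) = kronecker_prod (A * C) (B * D) $$ (i, j)" .
qed auto

lemma kronecker_prod_one: "kronecker_prod (1\<^sub>m n) (1\<^sub>m d) = (1\<^sub>m (n * d) :: 'a::comm_ring_1 mat)"
proof (rule eq_matI)
  fix i j assume "i < dim_row (1\<^sub>m (n * d) :: 'a mat)" "j < dim_col (1\<^sub>m (n * d) :: 'a mat)"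
  then have ij: "i < n * d" "j < n * d" by auto
  then have "d > 0" by (auto intro: Nat.gr0I)
  moreover have "i div d = j div d \<and> i mod d = j mod d \<longleftrightarrow> i = j" by (metis div_mod_decomp)
  ultimately show "kronecker_prod (1\<^sub>m n) (1\<^sub>m d) $$ (i, j) = (1\<^sub>m (n * d) :: 'a mat) $$ (i, j)"
    using ij by (auto simp: kronecker_prod_def less_mult_imp_div_less)
qed auto

lemma kronecker_prod_diff_left:
  fixes A B C :: "'a::comm_ring_1 mat"
  assumes "dim_row A = dim_row B" "dim_col A = dim_col B"
  shows "kronecker_prod (A - B) C = kronecker_prod A C - kronecker_prod B C"
  using assms by (intro eq_matI) (auto simp: kronecker_prod_def less_mult_imp_div_less algebra_simps)

lemma kronecker_prod_zero_left:
  "kronecker_prod (0\<^sub>m n m) (B :: 'a::comm_ring_1 mat) = 0\<^sub>m (n * dim_row B) (m * dim_col B)"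
  by (intro eq_matI) (auto simp: kronecker_prod_def less_mult_imp_div_less)

lemma finsum_mat_Suc:
  fixes f :: "nat \<Rightarrow> 'a::comm_ring_1 mat"
  assumes "f \<in> {..<Suc n} \<rightarrow> carrier_mat p q"
  shows "finsum (module_mat TYPE('a) p q) f {..<n} \<in> carrier_mat p q"
    and "finsum (module_mat TYPE('a) p q) f {..<Suc n} = f n + finsum (module_mat TYPE('a) p q) f {..<n}"
proof -
  interpret abelian_group "module_mat TYPE('a) p q" by (rule abelian_group_mat)
  have f: "f \<in> {..<n} \<rightarrow> carrier (module_mat TYPE('a) p q)" "f n \<in> carrier (module_mat TYPE('a) p q)"
    using assms by (auto simp: module_mat_simps)
  show "finsum (module_mat TYPE('a) p q) f {..<n} \<in> carrier_mat p q"
    using finsum_closed[OF f(1)] by (simp add: module_mat_simps)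
  show "finsum (module_mat TYPE('a) p q) f {..<Suc n} = f n + finsum (module_mat TYPE('a) p q) f {..<n}"
    using finsum_insert[of "{..<n}" n f] f by (simp add: lessThan_Suc module_mat_simps)
qed

lemma mult_finsum_left:
  fixes f :: "nat \<Rightarrow> 'a::comm_ring_1 mat"
  assumes f: "f \<in> {..<n} \<rightarrow> carrier_mat p q" and L: "L \<in> carrier_mat a p"
  shows "L * finsum (module_mat TYPE('a) p q) f {..<n} = finsum (module_mat TYPE('a) a q) (\<lambda>i. L * f i) {..<n}"
  using f
proof (induction n)
  case 0
  interpret P: abelian_group "module_mat TYPE('a) p q" by (rule abelian_group_mat)
  interpret A: abelian_group "module_mat TYPE('a) a q" by (rule abelian_group_mat)
  show ?case using L by (simp add: module_mat_simps)
next
  case (Suc n)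
  have g: "(\<lambda>i. L * f i) \<in> {..<Suc n} \<rightarrow> carrier_mat a q" using Suc.prems L by (auto simp: Pi_iff)
  have "f n \<in> carrier_mat p q" "f \<in> {..<n} \<rightarrow> carrier_mat p q" using Suc.prems by auto
  then show ?case
    unfolding finsum_mat_Suc(2)[OF Suc.prems] finsum_mat_Suc(2)[OF g]
    using Suc.IH finsum_mat_Suc(1)[OF Suc.prems] L by (simp add: mult_add_distrib_mat[of _ a p _ q])
qed

lemma mult_finsum_right:
  fixes f :: "nat \<Rightarrow> 'a::comm_ring_1 mat"
  assumes f: "f \<in> {..<n} \<rightarrow> carrier_mat p q" and R: "R \<in> carrier_mat q a"
  shows "finsum (module_mat TYPE('a) p q) f {..<n} * R = finsum (module_mat TYPE('a) p a) (\<lambda>i. f i * R) {..<n}"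
  using f
proof (induction n)
  case 0
  interpret P: abelian_group "module_mat TYPE('a) p q" by (rule abelian_group_mat)
  interpret A: abelian_group "module_mat TYPE('a) p a" by (rule abelian_group_mat)
  show ?case using R by (simp add: module_mat_simps)
next
  case (Suc n)
  have g: "(\<lambda>i. f i * R) \<in> {..<Suc n} \<rightarrow> carrier_mat p a" using Suc.prems R by (auto simp: Pi_iff intro!: mult_carrier_mat[of _ p q])
  have "f n \<in> carrier_mat p q" "f \<in> {..<n} \<rightarrow> carrier_mat p q" using Suc.prems by auto
  then show ?case
    unfolding finsum_mat_Suc(2)[OF Suc.prems] finsum_mat_Suc(2)[OF g]
    using Suc.IH finsum_mat_Suc(1)[OF Suc.prems] R by (simp add: add_mult_distrib_mat[of _ p q _ _ a])
qed

lemma blow_up_mult_left: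
  fixes \<X> :: "'a::field mat set"
  assumes M: "M \<in> blow_up p q d \<X>" and X: "\<X> \<subseteq> carrier_mat p q" and L: "L \<in> carrier_mat a p"
  shows "kronecker_prod L (1\<^sub>m d) * M \<in> blow_up a q d ((\<lambda>B. L * B) ` \<X>)"
proof -
  obtain n Y T where M: "M = finsum (module_mat TYPE('a) (p * d) (q * d)) (\<lambda>i. kronecker_prod (Y i) (T i)) {..<n::nat}"
    and Y: "Y \<in> {..<n} \<rightarrow> \<X>" and T: "T \<in> {..<n} \<rightarrow> carrier_mat d d"
    using M unfolding blow_up_def by blast
  have cY: "Y i \<in> carrier_mat p q" if "i < n" for i using Y X that by auto
  have cT: "T i \<in> carrier_mat d d" if "i < n" for i using T that by auto
  have c: "(\<lambda>i. kronecker_prod (Y i) (T i)) \<in> {..<n} \<rightarrow> carrier_mat (p * d) (q * d)"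
    using kronecker_prod_carrier[OF cY cT] by simp
  have LI: "kronecker_prod L (1\<^sub>m d) \<in> carrier_mat (a * d) (p * d)" using L by (auto intro!: carrier_matI)
  interpret abelian_group "module_mat TYPE('a) (a * d) (q * d)" by (rule abelian_group_mat)
  have "kronecker_prod L (1\<^sub>m d) * kronecker_prod (Y i) (T i) = kronecker_prod (L * Y i) (T i)" if "i < n" for i
    using cY[OF that] cT[OF that] L by (subst kronecker_prod_mult) auto
  moreover have "kronecker_prod (L * Y i) (T i) \<in> carrier_mat (a * d) (q * d)" if "i < n" for i
    using cY[OF that] cT[OF that] L by (auto intro!: carrier_matI)
  ultimately have "kronecker_prod L (1\<^sub>m d) * M
    = finsum (module_mat TYPE('a) (a * d) (q * d)) (\<lambda>i. kronecker_prod (L * Y i) (T i)) {..<n}"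
    unfolding M mult_finsum_left[OF c LI] by (intro finsum_cong') (auto simp: module_mat_simps)
  moreover have "(\<lambda>i. L * Y i) \<in> {..<n} \<rightarrow> (\<lambda>B. L * B) ` \<X>" using Y by auto
  ultimately show ?thesis unfolding blow_up_def using T
    by (intro CollectI exI[of _ n] exI[of _ "\<lambda>i. L * Y i"] exI[of _ T] conjI)
qed

lemma blow_up_mult_right:
  fixes \<X> :: "'a::field mat set"
  assumes M: "M \<in> blow_up p q d \<X>" and X: "\<X> \<subseteq> carrier_mat p q" and R: "R \<in> carrier_mat q a"
  shows "M * kronecker_prod R (1\<^sub>m d) \<in> blow_up p a d ((\<lambda>B. B * R) ` \<X>)"
proof -
  obtain n Y T where M: "M = finsum (module_mat TYPE('a) (p * d) (q * d)) (\<lambda>i. kronecker_prod (Y i) (T i)) {..<n::nat}"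
    and Y: "Y \<in> {..<n} \<rightarrow> \<X>" and T: "T \<in> {..<n} \<rightarrow> carrier_mat d d"
    using M unfolding blow_up_def by blast
  have cY: "Y i \<in> carrier_mat p q" if "i < n" for i using Y X that by auto
  have cT: "T i \<in> carrier_mat d d" if "i < n" for i using T that by auto
  have c: "(\<lambda>i. kronecker_prod (Y i) (T i)) \<in> {..<n} \<rightarrow> carrier_mat (p * d) (q * d)"
    using kronecker_prod_carrier[OF cY cT] by simp
  have RI: "kronecker_prod R (1\<^sub>m d) \<in> carrier_mat (q * d) (a * d)" using R by (auto intro!: carrier_matI)
  interpret abelian_group "module_mat TYPE('a) (p * d) (a * d)" by (rule abelian_group_mat)
  have "kronecker_prod (Y i) (T i) * kronecker_prod R (1\<^sub>m d) = kronecker_prod (Y i * R) (T i)" if "i < n" for i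
    using cY[OF that] cT[OF that] R by (subst kronecker_prod_mult) auto
  moreover have "kronecker_prod (Y i * R) (T i) \<in> carrier_mat (p * d) (a * d)" if "i < n" for i
    using cY[OF that] cT[OF that] R by (auto intro!: carrier_matI)
  ultimately have "M * kronecker_prod R (1\<^sub>m d)
    = finsum (module_mat TYPE('a) (p * d) (a * d)) (\<lambda>i. kronecker_prod (Y i * R) (T i)) {..<n}"
    unfolding M mult_finsum_right[OF c RI] by (intro finsum_cong') (auto simp: module_mat_simps)
  moreover have "(\<lambda>i. Y i * R) \<in> {..<n} \<rightarrow> (\<lambda>B. B * R) ` \<X>" using Y by auto
  ultimately show ?thesis unfolding blow_up_def using T
    by (intro CollectI exI[of _ n] exI[of _ "\<lambda>i. Y i * R"] exI[of _ T] conjI)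
qed

lemma blow_up_zero:
  fixes \<X> :: "'a::field mat set"
  assumes M: "M \<in> blow_up p q d \<X>" and X: "\<X> \<subseteq> {0\<^sub>m p q}"
  shows "M = 0\<^sub>m (p * d) (q * d)"
proof -
  obtain n Y T where M: "M = finsum (module_mat TYPE('a) (p * d) (q * d)) (\<lambda>i. kronecker_prod (Y i) (T i)) {..<n::nat}"
    and Y: "Y \<in> {..<n} \<rightarrow> \<X>" and T: "T \<in> {..<n} \<rightarrow> carrier_mat d d"
    using M unfolding blow_up_def by blast
  have cT: "T i \<in> carrier_mat d d" if "i < n" for i using T that by auto
  interpret abelian_group "module_mat TYPE('a) (p * d) (q * d)" by (rule abelian_group_mat)
  have "kronecker_prod (Y i) (T i) = 0\<^sub>m (p * d) (q * d)" if "i < n" for i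
  proof -
    have "Y i = 0\<^sub>m p q" using Y X that by auto
    then show ?thesis using cT[OF that] by (simp add: kronecker_prod_zero_left)
  qed
  then have "M = finsum (module_mat TYPE('a) (p * d) (q * d)) (\<lambda>i. 0\<^sub>m (p * d) (q * d)) {..<n}"
    unfolding M by (intro finsum_cong') (auto simp: module_mat_simps)
  also have "\<dots> = 0\<^sub>m (p * d) (q * d)" using finsum_zero[of "{..<n}"] by (simp add: module_mat_simps)
  finally show ?thesis .
qed

text \<open>Multiplying \<open>M\<close> by \<open>(1 - U V) \<otimes> 1\<close> discards only \<open>(U \<otimes> 1) (V \<otimes> 1) M\<close>, which factors
through a space of dimension \<open>r d\<close>.\<close>
lemma rank_le_complement_left:
  fixes M :: "'a::field mat"
  assumes M: "M \<in> carrier_mat (p * d) m" and U: "U \<in> carrier_mat p r" and V: "V \<in> carrier_mat r p"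
  shows "vec_space.rank (p * d) M \<le> r * d + vec_space.rank (p * d) (kronecker_prod (1\<^sub>m p - U * V) (1\<^sub>m d) * M)"
proof -
  let ?I = "1\<^sub>m d :: 'a mat"
  note [simp] = carrier_matD[OF M] carrier_matD[OF U] carrier_matD[OF V]
  have UV: "kronecker_prod (U * V) ?I = kronecker_prod U ?I * kronecker_prod V ?I"
    by (simp add: kronecker_prod_mult mat_units)
  have c: "kronecker_prod U ?I \<in> carrier_mat (p * d) (r * d)" "kronecker_prod V ?I * M \<in> carrier_mat (r * d) m"
    "kronecker_prod U ?I * (kronecker_prod V ?I * M) \<in> carrier_mat (p * d) m"
    "kronecker_prod (1\<^sub>m p - U * V) ?I * M \<in> carrier_mat (p * d) m"
    by (auto intro!: carrier_matI)
  have "kronecker_prod (1\<^sub>m p - U * V) ?I * M = M - kronecker_prod U ?I * (kronecker_prod V ?I * M)"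
    by (simp add: kronecker_prod_diff_left kronecker_prod_one UV mat_ring)
  then have "M = kronecker_prod U ?I * (kronecker_prod V ?I * M) + kronecker_prod (1\<^sub>m p - U * V) ?I * M"
    by (intro eq_matI) auto
  then have "vec_space.rank (p * d) M \<le> vec_space.rank (p * d) (kronecker_prod U ?I * (kronecker_prod V ?I * M))
    + vec_space.rank (p * d) (kronecker_prod (1\<^sub>m p - U * V) ?I * M)"
    using vec_space.rank_subadditive[OF c(3,4)] by simp
  moreover have "vec_space.rank (p * d) (kronecker_prod U ?I * (kronecker_prod V ?I * M)) \<le> r * d"
    using rank_mult_le_left[OF c(1,2)] vec_space.rank_le_nc[OF c(1)] by simp
  ultimately show ?thesis by simp
qed

lemma rank_le_complement_right:
  fixes M :: "'a::field mat"
  assumes M: "M \<in> carrier_mat m (q * d)" and U: "U \<in> carrier_mat q r" and V: "V \<in> carrier_mat r q"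
  shows "vec_space.rank m M \<le> r * d + vec_space.rank m (M * kronecker_prod (1\<^sub>m q - U * V) (1\<^sub>m d))"
proof -
  let ?I = "1\<^sub>m d :: 'a mat"
  note [simp] = carrier_matD[OF M] carrier_matD[OF U] carrier_matD[OF V]
  have UV: "kronecker_prod (U * V) ?I = kronecker_prod U ?I * kronecker_prod V ?I"
    by (simp add: kronecker_prod_mult mat_units)
  have c: "M * kronecker_prod U ?I \<in> carrier_mat m (r * d)" "kronecker_prod V ?I \<in> carrier_mat (r * d) (q * d)"
    "M * kronecker_prod U ?I * kronecker_prod V ?I \<in> carrier_mat m (q * d)"
    "M * kronecker_prod (1\<^sub>m q - U * V) ?I \<in> carrier_mat m (q * d)"
    by (auto intro!: carrier_matI)
  have "M * kronecker_prod (1\<^sub>m q - U * V) ?I = M - M * kronecker_prod U ?I * kronecker_prod V ?I"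
    by (simp add: kronecker_prod_diff_left kronecker_prod_one UV mat_ring)
  then have "M = M * kronecker_prod U ?I * kronecker_prod V ?I + M * kronecker_prod (1\<^sub>m q - U * V) ?I"
    by (intro eq_matI) auto
  then have "vec_space.rank m M \<le> vec_space.rank m (M * kronecker_prod U ?I * kronecker_prod V ?I)
    + vec_space.rank m (M * kronecker_prod (1\<^sub>m q - U * V) ?I)"
    using vec_space.rank_subadditive[OF c(3,4)] by simp
  moreover have "vec_space.rank m (M * kronecker_prod U ?I * kronecker_prod V ?I) \<le> r * d"
    using rank_mult_le_left[OF c(1,2)] vec_space.rank_le_nc[OF c(1)] by simp
  ultimately show ?thesis by simp
qed

section \<open>Spaces of matrices of bounded rank\<close>

lemma rank_0_imp_zero:
  fixes A :: "'a::field mat"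
  assumes A: "A \<in> carrier_mat n m" and "vec_space.rank n A = 0"
  shows "A = 0\<^sub>m n m"
proof -
  obtain S T where S: "S \<in> carrier_mat 0 n" and T: "T \<in> carrier_mat m 0" and ATSA: "A * T * S * A = A"
    using rank_compression[OF A] unfolding assms(2) by metis
  have "A * T * S = 0\<^sub>m n n" using A S T by (intro eq_matI) (auto simp: scalar_prod_def)
  then show ?thesis using ATSA A by (metis left_mult_zero_mat)
qed

text \<open>The matrices \<open>L B T\<close> and \<open>S B R\<close> have product zero and are composed through a space of dimension
\<open>r\<close>, so their ranks add up to at most \<open>r\<close>. Since \<open>L B R = 0\<close>, they carry the full ranks of \<open>L B\<close> and
\<open>B R\<close>.\<close>
lemma complementary_ranks:
  fixes A B :: "'a::field mat"
  assumes inf: "infinite (UNIV :: 'a set)"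
    and A: "A \<in> carrier_mat p q" and B: "B \<in> carrier_mat p q"
    and S: "S \<in> carrier_mat r p" and T: "T \<in> carrier_mat q r"
    and SAT: "S * A * T = 1\<^sub>m r" and ATSA: "A * T * S * A = A"
    and bound: "\<And>x. vec_space.rank p (A + x \<cdot>\<^sub>m B) \<le> r"
  shows "vec_space.rank p ((1\<^sub>m p - A * T * S) * B) + vec_space.rank p (B * (1\<^sub>m q - T * (S * A))) \<le> r"
proof -
  note [simp] = carrier_matD[OF A] carrier_matD[OF B] carrier_matD[OF S] carrier_matD[OF T]
  define L R where "L = 1\<^sub>m p - A * T * S" and "R = 1\<^sub>m q - T * (S * A)"
  have L: "L \<in> carrier_mat p p" and R: "R \<in> carrier_mat q q" unfolding L_def R_def by (auto intro!: carrier_matI)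
  note [simp] = carrier_matD[OF L] carrier_matD[OF R]
  have ATSA': "A * (T * (S * A)) = A" using ATSA by (simp add: mat_assoc)
  have LA: "L * A = 0\<^sub>m p q" unfolding L_def by (simp add: mat_ring ATSA')
  have AR: "A * R = 0\<^sub>m p q" unfolding R_def by (simp add: mat_ring ATSA')
  note z = maximal_rank_pencil[OF inf A B S T SAT bound L R LA AR]
  have cX: "L * B * T \<in> carrier_mat p r" and cY: "S * B * R \<in> carrier_mat r q"
    and SA: "S * A \<in> carrier_mat r q" and AT: "A * T \<in> carrier_mat p r" by (auto intro!: carrier_matI)
  have "L * B = L * B * R + (L * B * T) * (S * A)"
    unfolding R_def by (simp add: mat_ring) (intro eq_matI; simp)
  then have "L * B = (L * B * T) * (S * A)" unfolding z(1) by (simp add: mat_units)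
  then have "vec_space.rank p (L * B) \<le> vec_space.rank p (L * B * T)"
    using rank_mult_le_left[OF cX SA] by simp
  moreover have "B * R = L * (B * R) + (A * T) * (S * B * R)"
    unfolding L_def by (simp add: mat_ring) (intro eq_matI; simp)
  then have "B * R = (A * T) * (S * B * R)" using z(1) by (simp add: mat_units mat_assoc)
  then have "vec_space.rank p (B * R) \<le> vec_space.rank r (S * B * R)"
    using rank_mult_le_right[OF AT cY] by simp
  ultimately show ?thesis using sylvester_rank_le[OF cX cY z(2)] unfolding L_def R_def by simp
qed

text \<open>The preceding bound for two independently chosen members: in the pencil \<open>x B + C\<close> some member
\<open>D\<close> satisfies \<open>rank (L B) \<le> rank (L D)\<close> and \<open>rank (C R) \<le> rank (D R)\<close> at once. Consequently the
space \<open>L \<X>\<close> or the space \<open>\<X> R\<close> consists of matrices of rank at most \<open>r / 2\<close>.\<close>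
lemma complementary_ranks_of_space:
  fixes \<X> :: "'a::field mat set"
  assumes inf: "infinite (UNIV :: 'a set)"
    and X: "\<X> \<subseteq> carrier_mat p q" and lin: "\<And>c B C. B \<in> \<X> \<Longrightarrow> C \<in> \<X> \<Longrightarrow> c \<cdot>\<^sub>m B + C \<in> \<X>"
    and bound: "\<And>B. B \<in> \<X> \<Longrightarrow> vec_space.rank p B \<le> r"
    and A: "A \<in> \<X>"
    and S: "S \<in> carrier_mat r p" and T: "T \<in> carrier_mat q r"
    and SAT: "S * A * T = 1\<^sub>m r" and ATSA: "A * T * S * A = A"
    and B: "B \<in> \<X>" and C: "C \<in> \<X>"
  shows "vec_space.rank p ((1\<^sub>m p - A * T * S) * B) + vec_space.rank p (C * (1\<^sub>m q - T * (S * A))) \<le> r"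
proof -
  have cA: "A \<in> carrier_mat p q" and cB: "B \<in> carrier_mat p q" and cC: "C \<in> carrier_mat p q" using A B C X by auto
  note [simp] = carrier_matD[OF cA] carrier_matD[OF cB] carrier_matD[OF cC] carrier_matD[OF S] carrier_matD[OF T]
  define L R where "L = 1\<^sub>m p - A * T * S" and "R = 1\<^sub>m q - T * (S * A)"
  have L: "L \<in> carrier_mat p p" and R: "R \<in> carrier_mat q q" unfolding L_def R_def by (auto intro!: carrier_matI)
  note [simp] = carrier_matD[OF L] carrier_matD[OF R]
  have c: "L * B \<in> carrier_mat p q" "L * C \<in> carrier_mat p q" "C * R \<in> carrier_mat p q" "B * R \<in> carrier_mat p q"
    by (auto intro!: carrier_matI)
  have "finite ({x. vec_space.rank p (x \<cdot>\<^sub>m (L * B) + L * C) < vec_space.rank p (L * B)}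
    \<union> {x. vec_space.rank p (C * R + x \<cdot>\<^sub>m (B * R)) < vec_space.rank p (C * R)})"
    using finite_rank_drop_at_infinity[OF c(1,2)] finite_rank_drop[OF c(3,4)] by simp
  from ex_new_if_finite[OF inf this] obtain x where
    x: "vec_space.rank p (L * B) \<le> vec_space.rank p (x \<cdot>\<^sub>m (L * B) + L * C)"
       "vec_space.rank p (C * R) \<le> vec_space.rank p (C * R + x \<cdot>\<^sub>m (B * R))"
    by (auto simp: not_less)
  define D where "D = x \<cdot>\<^sub>m B + C"
  have D: "D \<in> \<X>" unfolding D_def using lin B C .
  then have cD: "D \<in> carrier_mat p q" using X by auto
  have "vec_space.rank p (A + y \<cdot>\<^sub>m D) \<le> r" for y
  proof -
    have "A + y \<cdot>\<^sub>m D = y \<cdot>\<^sub>m D + A" using cA cD by (intro comm_add_mat) auto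
    then show ?thesis using bound[OF lin[OF D A]] by simp
  qed
  from complementary_ranks[OF inf cA cD S T SAT ATSA this]
  have "vec_space.rank p (L * D) + vec_space.rank p (D * R) \<le> r" unfolding L_def R_def .
  moreover have "L * D = x \<cdot>\<^sub>m (L * B) + L * C" unfolding D_def by (simp add: mat_distrib mat_smult)
  moreover have "D * R = C * R + x \<cdot>\<^sub>m (B * R)" unfolding D_def
    by (simp add: mat_distrib mat_smult) (intro comm_add_mat[of _ p q]; use c in simp)
  ultimately show ?thesis using x unfolding L_def R_def by simp
qed

text \<open>Induction on \<open>r\<close>, through a member \<open>A\<close> of rank \<open>r\<close>. One of \<open>L \<X>\<close> and \<open>\<X> R\<close> has ranks at most
\<open>s = r div 2\<close>, so its blow-ups have rank at most \<open>(2 s - 1) d\<close>. Passing from \<open>\<X>\<close> to it loses at most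
\<open>r d\<close>, and \<open>r + (2 s - 1) \<le> 2 r - 1\<close>. The linear structure
enters as closure under \<open>c B + C\<close>, which \<open>L \<X>\<close> and \<open>\<X> R\<close> visibly inherit. Subtraction is truncated:
for \<open>r = 0\<close> or \<open>s = 0\<close> the bound \<open>0\<close> is the right one.\<close>
lemma rank_blow_up_le:
  fixes \<X> :: "'a::field mat set"
  assumes inf: "infinite (UNIV :: 'a set)"
    and X: "\<X> \<subseteq> carrier_mat p q" and lin: "\<And>c B C. B \<in> \<X> \<Longrightarrow> C \<in> \<X> \<Longrightarrow> c \<cdot>\<^sub>m B + C \<in> \<X>"
    and bound: "\<And>B. B \<in> \<X> \<Longrightarrow> vec_space.rank p B \<le> r"
    and M: "M \<in> blow_up p q d \<X>"
  shows "vec_space.rank (p * d) M \<le> (2 * r - 1) * d"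
  using X lin bound M
proof (induction r arbitrary: \<X> M rule: less_induct)
  case (less r)
  note X = less.prems(1) and lin = less.prems(2) and bound = less.prems(3) and M = less.prems(4)
  have cM: "M \<in> carrier_mat (p * d) (q * d)" using M blow_up_carrier[OF X] by blast
  \<comment> \<open>The second case, in which \<open>r\<close> is not attained, reduces to the bound \<open>r - 1\<close>.\<close>
  consider "r = 0" | "r > 0" "\<forall>B\<in>\<X>. vec_space.rank p B \<noteq> r" | A where "r > 0" "A \<in> \<X>" "vec_space.rank p A = r"
    by blast
  then show ?case
  proof cases
    case 1
    then have "B = 0\<^sub>m p q" if "B \<in> \<X>" for B
      using bound[OF that] rank_0_imp_zero[of B p q] X that by auto
    then have "\<X> \<subseteq> {0\<^sub>m p q}" by blast
    from blow_up_zero[OF M this] show ?thesis by (simp add: vec_space.rank_0I)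
  next
    case 2
    have "vec_space.rank p B \<le> r - 1" if "B \<in> \<X>" for B using bound[OF that] 2(2) that by (metis Suc_pred' le_SucE 2(1))
    with less.IH[of "r - 1", OF _ X lin _ M] have "vec_space.rank (p * d) M \<le> (2 * (r - 1) - 1) * d" using 2 by simp
    also have "\<dots> \<le> (2 * r - 1) * d" by (intro mult_le_mono1) simp
    finally show ?thesis .
  next
    case 3
    have cA: "A \<in> carrier_mat p q" using 3 X by auto
    obtain S T where S: "S \<in> carrier_mat r p" and T: "T \<in> carrier_mat q r"
      and SAT: "S * A * T = 1\<^sub>m r" and ATSA: "A * T * S * A = A"
      using rank_compression[OF cA] unfolding 3(3) by metis
    note [simp] = carrier_matD[OF cA] carrier_matD[OF S] carrier_matD[OF T]
    define L R where "L = 1\<^sub>m p - A * T * S" and "R = 1\<^sub>m q - T * (S * A)"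
    have L: "L \<in> carrier_mat p p" and R: "R \<in> carrier_mat q q" unfolding L_def R_def by (auto intro!: carrier_matI)
    have sum_le: "vec_space.rank p (L * B) + vec_space.rank p (C * R) \<le> r" if "B \<in> \<X>" "C \<in> \<X>" for B C
      using complementary_ranks_of_space[OF inf X lin bound 3(2) S T SAT ATSA that] unfolding L_def R_def by simp
    have half: "r div 2 < r" using 3 by simp
    have count: "r * d + (2 * (r div 2) - 1) * d \<le> (2 * r - 1) * d"
    proof -
      have "r + (2 * (r div 2) - 1) \<le> 2 * r - 1" using 3(1) by presburger
      from mult_le_mono1[OF this, of d] show ?thesis by (simp add: add_mult_distrib)
    qed
    show ?thesis
    proof (cases "\<forall>B\<in>\<X>. vec_space.rank p (L * B) \<le> r div 2")
      case True
      have "vec_space.rank (p * d) (kronecker_prod L (1\<^sub>m d) * M) \<le> (2 * (r div 2) - 1) * d"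
      proof (rule less.IH[OF half _ _ _ blow_up_mult_left[OF M X L]])
        show "(\<lambda>B. L * B) ` \<X> \<subseteq> carrier_mat p q" using X L by auto
        show "vec_space.rank p B \<le> r div 2" if "B \<in> (\<lambda>B. L * B) ` \<X>" for B using True that by auto
        show "c \<cdot>\<^sub>m B + C \<in> (\<lambda>B. L * B) ` \<X>" if "B \<in> (\<lambda>B. L * B) ` \<X>" "C \<in> (\<lambda>B. L * B) ` \<X>" for c B C
        proof -
          obtain B' C' where *: "B' \<in> \<X>" "C' \<in> \<X>" "B = L * B'" "C = L * C'" using \<open>B \<in> _\<close> \<open>C \<in> _\<close> by auto
          then have "B' \<in> carrier_mat p q" "C' \<in> carrier_mat p q" using X by auto
          then have "c \<cdot>\<^sub>m B + C = L * (c \<cdot>\<^sub>m B' + C')" using * L by (simp add: mat_distrib mat_smult)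
          then show ?thesis using lin * by blast
        qed
      qed
      then show ?thesis
        using rank_le_complement_left[OF cM, of "A * T" r S] cA S T count unfolding L_def by simp
    next
      case False
      then obtain B where "B \<in> \<X>" "r div 2 < vec_space.rank p (L * B)" by auto
      then have le: "vec_space.rank p (C * R) \<le> r div 2" if "C \<in> \<X>" for C using sum_le[of B C] that by linarith
      have "vec_space.rank (p * d) (M * kronecker_prod R (1\<^sub>m d)) \<le> (2 * (r div 2) - 1) * d"
      proof (rule less.IH[OF half _ _ _ blow_up_mult_right[OF M X R]])
        show "(\<lambda>B. B * R) ` \<X> \<subseteq> carrier_mat p q" using X R by auto
        show "vec_space.rank p B \<le> r div 2" if "B \<in> (\<lambda>B. B * R) ` \<X>" for B using le that by auto
        show "c \<cdot>\<^sub>m B + C \<in> (\<lambda>B. B * R) ` \<X>" if "B \<in> (\<lambda>B. B * R) ` \<X>" "C \<in> (\<lambda>B. B * R) ` \<X>" for c B C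
        proof -
          obtain B' C' where *: "B' \<in> \<X>" "C' \<in> \<X>" "B = B' * R" "C = C' * R" using \<open>B \<in> _\<close> \<open>C \<in> _\<close> by auto
          then have "B' \<in> carrier_mat p q" "C' \<in> carrier_mat p q" using X by auto
          then have "c \<cdot>\<^sub>m B + C = (c \<cdot>\<^sub>m B' + C') * R" using * R by (simp add: mat_distrib mat_smult)
          then show ?thesis using lin * by blast
        qed
      qed
      then show ?thesis
        using rank_le_complement_right[OF cM, of T r "S * A"] cA S T count unfolding R_def by simp
    qed
  qed
qed

theorem proposition1p11:
  fixes \<X> :: "'a::field mat set" and p q :: nat
  assumes "infinite (UNIV :: 'a set)"
    and "VectorSpace.subspace class_ring \<X> (module_mat TYPE('a) p q)"
    and "\<X> \<noteq> {0\<^sub>m p q}"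
  shows "ncrk p q \<X> < 2 * real (max_rank p \<X>)"
proof -
  define r where "r = max_rank p \<X>"
  have sm: "submodule class_ring \<X> (module_mat TYPE('a) p q)" using assms(2) by (simp add: subspace_def)
  have X: "\<X> \<subseteq> carrier_mat p q" using submodule.subset[OF sm] by (simp add: module_mat_simps)
  have zero: "0\<^sub>m p q \<in> \<X>" using submodule.zero_closed[OF sm] by (simp add: module_mat_simps)
  have lin: "c \<cdot>\<^sub>m B + C \<in> \<X>" if "B \<in> \<X>" "C \<in> \<X>" for c B C
    using submodule.m_closed[OF sm submodule.smult_closed[OF sm _ that(1), of c] that(2)]
    by (simp add: module_mat_simps class_ring_simps)
  have bound: "vec_space.rank p B \<le> r" if "B \<in> \<X>" for B
    unfolding r_def max_rank_def using that finite_ranks[OF X] by simp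
  have "r > 0"
  proof (rule ccontr)
    assume "\<not> r > 0"
    then have "B = 0\<^sub>m p q" if "B \<in> \<X>" for B
      using bound[OF that] rank_0_imp_zero[of B p q] X that by auto
    with zero assms(3) show False by blast
  qed
  have "real (max_rank (p * d) (blow_up p q d \<X>)) / real d \<le> 2 * real r - 1" if "d \<in> {1..}" for d
  proof -
    have "max_rank (p * d) (blow_up p q d \<X>) \<in> vec_space.rank (p * d) ` blow_up p q d \<X>"
      unfolding max_rank_def
      using Max_in[OF finite_ranks[OF blow_up_carrier[OF X]]] zero_in_blow_up[of p d q \<X>] by blast
    then have "max_rank (p * d) (blow_up p q d \<X>) \<le> (2 * r - 1) * d"
      using rank_blow_up_le[OF assms(1) X lin bound] by auto
    then have "real (max_rank (p * d) (blow_up p q d \<X>)) \<le> real ((2 * r - 1) * d)" by (rule of_nat_mono)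
    also have "\<dots> = (2 * real r - 1) * real d" using \<open>r > 0\<close> by (simp add: of_nat_diff)
    finally show ?thesis using that by (simp add: divide_le_eq)
  qed
  then have "ncrk p q \<X> \<le> 2 * real r - 1" unfolding ncrk_def by (intro cSUP_least) auto
  then show ?thesis unfolding r_def by simp
qed

end
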